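(* Let $\beta\in\mathbb C$ with $|\beta|>1$. There exists a finite set $\mathcal A\subset\mathbb Q(\beta)$ such that $(\beta,\mathcal A)$ admits weak-greedy eventually periodic representations of $\mathbb Q(\beta)$ if and only if $\beta$ is an algebraic integer such that every Galois conjugate $\beta'$ of $\beta$ with $|\beta'|>1$ is equal to $\beta$ or to its complex conjugate $\overline{\beta}$.
   Context: For $\beta\in\mathbb C$ with $|\beta|>1$ and a finite alphabet $\mathcal A\subset\mathbb C$, a $(\beta,\mathcal A)$-representation of $x\in\mathbb C$ is an expression $x=\sum_{i=-L}^{+\infty}a_i\beta^{-i}$ with $L\in\mathbb Z$ and all $a_i\in\mathcal A$; it is eventually periodic if the digit sequence is eventually periodic. We say that $(\beta,\mathcal A)$ admits weak-greedy eventually periodic representations of $\mathbb Q(\beta)$ if there is $c>0$ such that every $x\in\mathbb Q(\beta)$ with $|x|<c$ has an eventually periodic $(\beta,\mathcal A)$-representation of the form $x=\sum_{i=1}^{+\infty}a_i\beta^{-i}$, $a_i\in\mathcal A$. *)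

theory Defs
  imports "HOL-Analysis.Analysis" "HOL-Computational_Algebra.Computational_Algebra"
begin

text \<open>
  The subfield of the complex numbers generated by \<open>\<beta>\<close>. Every subfield has characteristic 0, so
  \<open>\<rat>\<close> is included without a clause of its own. The number \<open>\<beta>\<close> need not be algebraic.
\<close>

inductive_set rat_adjoin :: "complex \<Rightarrow> complex set" for \<beta> :: complex where
  one: "1 \<in> rat_adjoin \<beta>"
| gen: "\<beta> \<in> rat_adjoin \<beta>"
| add: "x \<in> rat_adjoin \<beta> \<Longrightarrow> y \<in> rat_adjoin \<beta> \<Longrightarrow> x + y \<in> rat_adjoin \<beta>"
| uminus: "x \<in> rat_adjoin \<beta> \<Longrightarrow> - x \<in> rat_adjoin \<beta>"
| mult: "x \<in> rat_adjoin \<beta> \<Longrightarrow> y \<in> rat_adjoin \<beta> \<Longrightarrow> x * y \<in> rat_adjoin \<beta>"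
| inverse: "x \<in> rat_adjoin \<beta> \<Longrightarrow> x \<noteq> 0 \<Longrightarrow> inverse x \<in> rat_adjoin \<beta>"

definition is_min_poly :: "rat poly \<Rightarrow> complex \<Rightarrow> bool" where
  "is_min_poly p x \<longleftrightarrow>
     lead_coeff p = 1 \<and> poly (map_poly of_rat p) x = 0 \<and>
     (\<forall>q. q \<noteq> 0 \<and> poly (map_poly of_rat q) x = 0 \<longrightarrow> degree p \<le> degree q)"

text \<open>Every algebraic number is a conjugate of itself; a transcendental one has no conjugates.\<close>

definition galois_conjugate :: "complex \<Rightarrow> complex \<Rightarrow> bool" where
  "galois_conjugate x y \<longleftrightarrow> (\<exists>p. is_min_poly p x \<and> poly (map_poly of_rat p) y = 0)"

text \<open>
  The representation \<open>x = (\<Sum>i = -L..\<infinity>. a i * \<beta> powi (-i))\<close> with all digits in \<open>A\<close>. The series is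
  summed over \<open>n = i + L\<close>. Only the values \<open>a i\<close> with \<open>i \<ge> -L\<close> matter.
\<close>

definition is_representation ::
    "complex \<Rightarrow> complex set \<Rightarrow> int \<Rightarrow> (int \<Rightarrow> complex) \<Rightarrow> complex \<Rightarrow> bool" where
  "is_representation \<beta> A L a x \<longleftrightarrow>
     (\<forall>i \<ge> -L. a i \<in> A) \<and>
     (\<lambda>n. a (int n - L) * \<beta> powi (- (int n - L))) sums x"

definition eventually_periodic :: "(int \<Rightarrow> 'a) \<Rightarrow> bool" where
  "eventually_periodic a \<longleftrightarrow> (\<exists>N p. p > 0 \<and> (\<forall>i \<ge> N. a (i + p) = a i))"

text \<open>Here \<open>L = -1\<close>, so the representations have the form \<open>x = (\<Sum>i = 1..\<infinity>. a i * \<beta> powi (-i))\<close>.\<close>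

definition admits_weak_greedy_ep :: "complex \<Rightarrow> complex set \<Rightarrow> bool" where
  "admits_weak_greedy_ep \<beta> A \<longleftrightarrow>
     (\<exists>c::real. c > 0 \<and>
        (\<forall>x \<in> rat_adjoin \<beta>. norm x < c \<longrightarrow>
           (\<exists>a. is_representation \<beta> A (-1) a x \<and> eventually_periodic a)))"

end

theory Submission
  imports Defs "HOL-Computational_Algebra.Field_as_Ring"
begin

text \<open>
  An eventually periodic representation of \<open>x\<close> amounts to an eventually periodic orbit
  \<open>X 0 = x\<close>, \<open>X (n + 1) = \<beta> * X n - (digit)\<close>.

  Necessity. Let \<open>\<gamma> = 1 / \<beta>\<close> and let \<open>D\<close> be a common denominator in \<open>\<int>[\<gamma>]\<close> of the digits.
  A representation of \<open>1 / (D * k)\<close> with period \<open>p\<close> shows \<open>1 - \<gamma> ^ p \<in> k * \<gamma> * \<int>[\<gamma>]\<close>, hence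
  \<open>1 \<in> \<gamma> * \<int>[\<gamma>]\<close>, and \<open>\<beta>\<close> is an algebraic integer; neither valuations nor the algebraicity of
  \<open>\<beta>\<close> are needed. If \<open>y\<close> is a conjugate with \<open>norm y > 1\<close> other than \<open>\<beta>\<close> and \<open>cnj \<beta>\<close>, some
  small \<open>x\<close> has so large a conjugate at \<open>y\<close> that the conjugate orbit grows strictly in norm,
  contradicting periodicity.

  Sufficiency. Jointly in all conjugates, \<open>\<int>[\<beta>]\<close> is a lattice of some covering radius \<open>R\<close>. Choose
  the digit of a state \<open>x\<close> so that at every conjugate \<open>z\<close> of \<open>\<beta>\<close> it lies within \<open>R\<close> of the product
  of \<open>z\<close> and the conjugate of \<open>x\<close>, truncated to norm \<open>T = norm \<beta> * R\<close>. The conjugates of the states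
  then stay bounded, even where \<open>norm z = 1\<close>, so the orbit runs through a finite set; it is
  eventually periodic because the digit depends only on the state.
\<close>

section \<open>Minimal polynomials\<close>

lemma map_poly_hom_add:
  assumes "f 0 = 0" "\<And>x y. f (x + y) = f x + f y"
  shows "map_poly f (p + q) = map_poly f p + map_poly f q"
  using assms by (intro poly_eqI) (simp add: coeff_map_poly)

lemma map_poly_hom_mult:
  fixes f :: "'a::comm_semiring_0 \<Rightarrow> 'b::comm_semiring_0"
  assumes "f 0 = 0" "\<And>x y. f (x + y) = f x + f y" "\<And>x y. f (x * y) = f x * f y"
  shows "map_poly f (p * q) = map_poly f p * map_poly f q"
proof (induction p)
  case (pCons a p)
  have "map_poly f (smult a q) = smult (f a) (map_poly f q)"
    using assms by (intro poly_eqI) (simp add: coeff_map_poly)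
  then show ?case
    using pCons assms by (simp add: map_poly_pCons map_poly_hom_add)
qed (simp add: assms)

abbreviation rpoly :: "rat poly \<Rightarrow> complex \<Rightarrow> complex" where
  "rpoly p z \<equiv> poly (map_poly of_rat p) z"

abbreviation ipoly :: "int poly \<Rightarrow> complex \<Rightarrow> complex" where
  "ipoly p z \<equiv> poly (map_poly of_int p) z"

lemma rpoly_add: "rpoly (p + q) z = rpoly p z + rpoly q z"
  by (simp add: map_poly_hom_add of_rat_add)

lemma rpoly_mult: "rpoly (p * q) z = rpoly p z * rpoly q z"
  by (simp add: map_poly_hom_mult of_rat_add of_rat_mult)

lemma rpoly_smult: "rpoly (smult c p) z = of_rat c * rpoly p z"
  by (simp add: map_poly_smult of_rat_mult)

lemma rpoly_minus: "rpoly (- p) z = - rpoly p z"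
  using rpoly_smult[of "-1" p z] by simp

lemma rpoly_diff: "rpoly (p - q) z = rpoly p z - rpoly q z"
  using rpoly_add[of p "- q" z] by (simp add: rpoly_minus)

lemma rpoly_pCons: "rpoly (pCons c p) z = of_rat c + z * rpoly p z"
  by (simp add: map_poly_pCons)

lemmas rpoly_simps = rpoly_add rpoly_mult rpoly_smult rpoly_minus rpoly_diff rpoly_pCons

lemma rpoly_of_int: "rpoly (map_poly of_int p) z = ipoly p z"
  by (simp add: map_poly_map_poly o_def)

lemma ipoly_add: "ipoly (p + q) z = ipoly p z + ipoly q z"
  by (simp add: map_poly_hom_add)

lemma ipoly_mult: "ipoly (p * q) z = ipoly p z * ipoly q z"
  by (simp add: map_poly_hom_mult)

lemma ipoly_smult: "ipoly (smult c p) z = of_int c * ipoly p z"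
  by (simp add: map_poly_smult)

lemma ipoly_minus: "ipoly (- p) z = - ipoly p z"
  using ipoly_smult[of "-1" p z] by simp

lemma ipoly_diff: "ipoly (p - q) z = ipoly p z - ipoly q z"
  using ipoly_add[of p "- q" z] by (simp add: ipoly_minus)

lemma ipoly_pCons: "ipoly (pCons c p) z = of_int c + z * ipoly p z"
  by (simp add: map_poly_pCons)

lemmas ipoly_simps = ipoly_add ipoly_mult ipoly_smult ipoly_minus ipoly_diff ipoly_pCons

lemma ipoly_cnj: "ipoly p (cnj z) = cnj (ipoly p z)"
  by (induction p) (simp_all add: ipoly_pCons)

lemma rpoly_cnj: "rpoly p (cnj z) = cnj (rpoly p z)"
proof (induction p)
  case (pCons a p)
  have "cnj (of_rat a) = of_rat a"
    by (cases a rule: Rat_cases) (simp add: of_rat_rat)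
  with pCons show ?case by (simp add: rpoly_pCons)
qed simp

lemma map_poly_of_rat_eq_0_iff:
  "map_poly (of_rat :: rat \<Rightarrow> 'a::field_char_0) p = 0 \<longleftrightarrow> p = 0"
  by (simp add: map_poly_eq_0_iff)

lemma degree_map_poly_of_rat:
  "degree (map_poly (of_rat :: rat \<Rightarrow> 'a::field_char_0) p) = degree p"
  by (cases "p = 0") (simp_all add: map_poly_degree_eq)

lemma degree_map_poly_of_int:
  "degree (map_poly (of_int :: int \<Rightarrow> 'a::ring_char_0) p) = degree p"
  by (cases "p = 0") (simp_all add: map_poly_degree_eq)

lemma clear_denominators:
  fixes p :: "rat poly"
  obtains q :: int and g :: "int poly" where "q > 0" "smult (of_int q) p = map_poly of_int g"
proof -
  have "\<exists>(q::int) g. q > 0 \<and> smult (of_int q) p = map_poly of_int g"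
  proof (induction p)
    case (pCons a p)
    then obtain q :: int and g where IH: "q > 0" "smult (of_int q) p = map_poly of_int g" by blast
    obtain n d :: int where a: "a = of_int n / of_int d" "d > 0"
      by (metis quotient_of_denom_pos quotient_of_div surj_pair)
    have "smult (of_int (q * d)) (pCons a p) =
        pCons (of_int (q * n)) (smult (of_int d) (smult (of_int q) p))"
      using a by (simp add: mult.commute)
    also have "\<dots> = map_poly of_int (pCons (q * n) (smult d g))"
      using IH by (simp add: map_poly_pCons map_poly_smult)
    finally show ?case
      using IH a by (intro exI[of _ "q * d"] exI[of _ "pCons (q * n) (smult d g)"]) auto
  qed (auto intro: exI[of _ 1] exI[of _ 0])
  then show ?thesis using that by blast
qed

lemma is_min_poly_degree_le:
  "is_min_poly p x \<Longrightarrow> q \<noteq> 0 \<Longrightarrow> rpoly q x = 0 \<Longrightarrow> degree p \<le> degree q"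
  by (simp add: is_min_poly_def)

lemma is_min_poly_rootD: "is_min_poly p x \<Longrightarrow> rpoly p x = 0"
  and is_min_poly_lead: "is_min_poly p x \<Longrightarrow> lead_coeff p = 1"
  and is_min_poly_neq_0: "is_min_poly p x \<Longrightarrow> p \<noteq> 0"
  by (auto simp: is_min_poly_def)

lemma is_min_poly_dvd:
  assumes "is_min_poly p x" "rpoly h x = 0"
  shows "p dvd h"
proof (rule ccontr)
  assume "\<not> p dvd h"
  then have nz: "h mod p \<noteq> 0" by (simp add: dvd_eq_mod_eq_0)
  have "h mod p = h - h div p * p" by (simp add: minus_div_mult_eq_mod)
  then have "rpoly (h mod p) x = 0"
    using assms is_min_poly_rootD[OF assms(1)] by (simp add: rpoly_simps)
  with assms(1) nz have "degree p \<le> degree (h mod p)" by (rule is_min_poly_degree_le)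
  moreover have "degree (h mod p) < degree p"
    using nz degree_mod_less'[OF is_min_poly_neq_0[OF assms(1)] nz] by simp
  ultimately show False by simp
qed

text \<open>Applied to differences, this makes the conjugation from \<open>h\<close> at
  \<open>x\<close> to \<open>h\<close> at \<open>y\<close> well defined.\<close>

lemma is_min_poly_transfer:
  assumes "is_min_poly p x" "rpoly p y = 0" "rpoly h x = 0"
  shows "rpoly h y = 0"
  using is_min_poly_dvd[OF assms(1,3)] assms(2) by (auto simp: dvd_def rpoly_mult)

lemma algebraic_min_poly:
  assumes "algebraic x"
  obtains p where "is_min_poly p x"
proof -
  obtain g where g: "ipoly g x = 0" "g \<noteq> 0"
    using assms by (rule algebraicE')
  define S where "S = {q. q \<noteq> 0 \<and> rpoly q x = 0}"
  have "map_poly of_int g \<in> S"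
    using g by (simp add: S_def rpoly_of_int map_poly_eq_0_iff)
  then obtain p where p: "p \<in> S" "\<And>q. q \<in> S \<Longrightarrow> degree p \<le> degree q"
    using ex_has_least_nat[of "\<lambda>q. q \<in> S" _ degree] by blast
  have "is_min_poly (smult (inverse (lead_coeff p)) p) x"
    using p by (auto simp: is_min_poly_def S_def rpoly_smult)
  then show ?thesis by (rule that)
qed

lemma degree_min_poly_pos:
  assumes "is_min_poly p x"
  shows "degree p > 0"
proof (rule ccontr)
  assume "\<not> degree p > 0"
  then obtain c where "p = [:c:]" using degree_0_id by (metis not_gr_zero)
  then show False
    using is_min_poly_lead[OF assms] is_min_poly_rootD[OF assms] by (simp add: map_poly_pCons)
qed

text \<open>Irreducibility: one factor vanishes at \<open>x\<close>, so by minimality it has the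
  full degree of \<open>p\<close>.\<close>

lemma min_poly_factor:
  assumes "is_min_poly p x" "p = g * k"
  shows "degree g = 0 \<or> degree k = 0"
proof -
  have nz: "g \<noteq> 0" "k \<noteq> 0" using is_min_poly_neq_0[OF assms(1)] assms(2) by auto
  have deg: "degree p = degree g + degree k" using nz assms(2) by (simp add: degree_mult_eq)
  have "rpoly g x = 0 \<or> rpoly k x = 0"
    using is_min_poly_rootD[OF assms(1)] assms(2) by (simp add: rpoly_mult)
  then show ?thesis
    using is_min_poly_degree_le[OF assms(1)] nz deg by fastforce
qed

text \<open>The minimal polynomial of \<open>y\<close> divides \<open>p\<close>, and by
  irreducibility the cofactor is constant; hence \<open>p\<close> has the least degree at
  \<open>y\<close> as well.\<close>

lemma is_min_poly_conjugate:
  assumes "is_min_poly p x" "rpoly p y = 0"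
  shows "is_min_poly p y"
proof -
  have "algebraic y"
    using assms is_min_poly_neq_0[OF assms(1)]
    by (intro algebraicI'[of "map_poly of_rat p"])
      (simp_all add: coeff_map_poly map_poly_of_rat_eq_0_iff)
  then obtain m where m: "is_min_poly m y" by (rule algebraic_min_poly)
  then obtain k where k: "p = m * k" using is_min_poly_dvd[OF m assms(2)] by blast
  have "degree k = 0"
    using min_poly_factor[OF assms(1) k] degree_min_poly_pos[OF m] by simp
  then have "degree p = degree m"
    using k is_min_poly_neq_0[OF assms(1)] by (simp add: degree_mult_eq)
  then show ?thesis
    using m assms is_min_poly_lead[OF assms(1)] by (auto simp: is_min_poly_def)
qed

text \<open>A double root would be a root of the derivative, which is nonzero and of smaller degree,
  while \<open>p\<close> is the minimal polynomial of each of its roots. Hence polynomials of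
  smaller degree are determined by their values at the conjugates.\<close>

lemma card_min_poly_roots:
  assumes "is_min_poly p x"
  shows "card {z. rpoly p z = 0} = degree p"
proof -
  let ?P = "map_poly of_rat p :: complex poly"
  have pd: "map_poly of_rat (pderiv p) = pderiv ?P"
    by (intro poly_eqI) (simp add: coeff_map_poly coeff_pderiv of_rat_mult of_rat_add)
  have "rsquarefree ?P"
    unfolding rsquarefree_roots
  proof (intro allI notI)
    fix z assume z: "rpoly p z = 0 \<and> poly (pderiv ?P) z = 0"
    have min: "is_min_poly p z" using is_min_poly_conjugate[OF assms] z by blast
    have "pderiv p \<noteq> 0" using degree_min_poly_pos[OF assms] by (simp add: pderiv_eq_0_iff)
    then have "degree p \<le> degree (pderiv p)"
      using is_min_poly_degree_le[OF min] z pd by simp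
    then show False using degree_min_poly_pos[OF assms] by (simp add: degree_pderiv)
  qed
  then have "?P = smult (lead_coeff ?P) (\<Prod>z | rpoly p z = 0. [:-z, 1:])"
    by (rule complex_poly_decompose_rsquarefree[symmetric])
  moreover have "lead_coeff ?P \<noteq> 0"
    using is_min_poly_neq_0[OF assms] by (simp add: map_poly_of_rat_eq_0_iff)
  ultimately have "degree ?P = degree (\<Prod>z | rpoly p z = 0. [:-z, 1::complex:])"
    by (metis degree_smult_eq)
  also have "\<dots> = card {z. rpoly p z = 0}"
    by (subst degree_prod_eq_sum_degree) auto
  finally show ?thesis by (simp add: degree_map_poly_of_rat)
qed

text \<open>Gauss's lemma. \<open>p\<close> divides a monic integer polynomial \<open>f\<close>;
  both \<open>p\<close> and the monic cofactor are scaled to primitive integer polynomials. The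
  product of these has content 1, so the scaling factors are units.\<close>

lemma min_poly_integral:
  assumes "algebraic_int x" "is_min_poly p x"
  obtains P :: "int poly" where "p = map_poly of_int P" "lead_coeff P = 1"
proof -
  have prim: "\<exists>(l::int) G. l \<noteq> 0 \<and> content G = 1 \<and> smult (of_int l) r = map_poly of_int G"
    if r: "lead_coeff r = 1" for r :: "rat poly"
  proof -
    obtain q :: int and g where q: "q > 0" "smult (of_int q) r = map_poly of_int g"
      by (rule clear_denominators)
    have nz: "g \<noteq> 0" "content g \<noteq> 0" using q r by (auto simp: map_poly_eq_0_iff)
    \<comment> \<open>As \<open>r\<close> is monic, the leading coefficient of \<open>g\<close> is
      \<open>q\<close>; so the content of \<open>g\<close> divides \<open>q\<close> and can be
      cancelled.\<close>
    have "of_int q = (of_int (lead_coeff g) :: rat)"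
      using arg_cong[OF q(2), of lead_coeff] r q(1)
      by (simp add: degree_map_poly_of_int coeff_map_poly)
    then have "q = lead_coeff g" by (simp only: of_int_eq_iff)
    then obtain l where l: "q = content g * l" by (meson content_dvd_coeff dvdE)
    obtain G where G: "g = smult (content g) G" "content G = 1" by (rule content_decompose)
    have eq: "smult (of_int (content g)) (smult (of_int l) r) = map_poly of_int (smult (content g) G)"
      using q(2) by (simp only: l of_int_mult smult_smult flip: G(1))
    have "of_int (content g) * (of_int l * coeff r i) = of_int (content g) * of_int (coeff G i)"
      for i using arg_cong[OF eq, of "\<lambda>p. coeff p i"] by (auto simp: coeff_map_poly)
    then have "smult (of_int l) r = map_poly of_int G"
      using nz(2) by (intro poly_eqI) (simp add: coeff_map_poly)
    moreover have "l \<noteq> 0" using l q(1) by auto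
    moreover note G(2)
    ultimately show ?thesis by blast
  qed
  obtain f where f: "ipoly f x = 0" "lead_coeff f = 1"
    using assms(1) by (auto simp: algebraic_int_altdef_ipoly)
  obtain k where k: "map_poly of_int f = p * k"
    using is_min_poly_dvd[OF assms(2), of "map_poly of_int f"] f by (auto simp: rpoly_of_int)
  have lp: "lead_coeff p = 1" by (rule is_min_poly_lead[OF assms(2)])
  have "lead_coeff (p * k) = 1"
    using f by (simp flip: k add: degree_map_poly_of_int coeff_map_poly)
  then have lk: "lead_coeff k = 1" using lp by (simp add: lead_coeff_mult)
  obtain l G where G: "l \<noteq> 0" "content G = 1" "smult (of_int l) p = map_poly of_int G"
    using prim[OF lp] by blast
  obtain m H where H: "m \<noteq> 0" "content H = 1" "smult (of_int m) k = map_poly of_int H"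
    using prim[OF lk] by blast
  have "map_poly (of_int :: int \<Rightarrow> rat) (smult (l * m) f) = smult (of_int (l * m)) (p * k)"
    by (simp add: map_poly_smult k)
  also have "\<dots> = map_poly of_int (G * H)"
    by (simp add: map_poly_hom_mult mult.commute flip: G(3) H(3))
  finally have eq: "map_poly (of_int :: int \<Rightarrow> rat) (smult (l * m) f) = map_poly of_int (G * H)" .
  have "coeff (smult (l * m) f) n = coeff (G * H) n" for n
    using arg_cong[OF eq, of "\<lambda>p. coeff p n"] by (simp only: coeff_map_poly of_int_0 of_int_eq_iff)
  then have "smult (l * m) f = G * H" by (rule poly_eqI)
  then have "content (smult (l * m) f) = content (G * H)" by simp
  then have "\<bar>l * m\<bar> * content f = 1" using G H by (simp add: content_mult)
  then have "is_unit (l * m)" by (metis abs_dvd_iff dvd_triv_left)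
  then have "is_unit l" by (rule is_unit_mult_iff[THEN iffD1, THEN conjunct1])
  then have ll: "l * l = 1" by (auto simp: zdvd1_eq abs_if split: if_splits)
  \<comment> \<open>\<open>l\<close> is 1 or -1, so a second multiplication by \<open>l\<close>
    returns \<open>p\<close>.\<close>
  have "map_poly of_int (smult l G) = smult (of_int l) (smult (of_int l) p)"
    by (simp add: map_poly_smult G)
  also have "\<dots> = p" using ll by (simp flip: of_int_mult)
  finally have P: "map_poly of_int (smult l G) = p" .
  moreover have "lead_coeff (smult l G) = 1"
    using lp by (simp flip: P add: degree_map_poly_of_int coeff_map_poly flip: of_int_mult)
  ultimately show ?thesis using that[of "smult l G"] by simp
qed

section \<open>The field generated by \<open>\<beta>\<close>\<close>

lemma rat_adjoin_of_int: "of_int n \<in> rat_adjoin \<beta>"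
proof -
  have "1 + - 1 \<in> rat_adjoin \<beta>" by (intro rat_adjoin.intros)
  then have 0: "0 \<in> rat_adjoin \<beta>" by simp
  have nat: "of_nat k \<in> rat_adjoin \<beta>" for k
    by (induction k) (auto simp: 0 intro: rat_adjoin.intros)
  show ?thesis
    by (cases n rule: int_cases2) (auto simp: nat intro: rat_adjoin.uminus)
qed

lemma rat_adjoin_divide:
  "x \<in> rat_adjoin \<beta> \<Longrightarrow> y \<in> rat_adjoin \<beta> \<Longrightarrow> x / y \<in> rat_adjoin \<beta>"
  using rat_adjoin_of_int[of 0]
  by (cases "y = 0") (auto simp: divide_inverse intro: rat_adjoin.intros)

lemma rat_adjoin_rpoly: "x \<in> rat_adjoin \<beta> \<Longrightarrow> rpoly h x \<in> rat_adjoin \<beta>"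
proof (induction h)
  case (pCons c h)
  have "of_rat c \<in> rat_adjoin \<beta>"
    by (cases c rule: Rat_cases) (simp add: of_rat_rat rat_adjoin_divide rat_adjoin_of_int)
  then show ?case using pCons by (auto simp: rpoly_pCons intro: rat_adjoin.intros)
qed (use rat_adjoin_of_int[of 0] in simp)

lemma rat_adjoin_ipoly: "x \<in> rat_adjoin \<beta> \<Longrightarrow> ipoly h x \<in> rat_adjoin \<beta>"
  using rat_adjoin_rpoly[of x \<beta> "map_poly of_int h"] by (simp add: rpoly_of_int)

text \<open>For algebraic \<open>\<beta>\<close> the polynomial expressions already form a field.
  Inverses come from a Bezout identity for \<open>p\<close> and \<open>h\<close>, whose gcd is
  constant.\<close>

lemma rat_adjoin_eq_rpoly:
  assumes p: "is_min_poly p \<beta>" and "x \<in> rat_adjoin \<beta>"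
  shows "\<exists>h. x = rpoly h \<beta>"
  using assms(2)
proof induction
  case one
  show ?case by (rule exI[of _ 1]) simp
next
  case gen
  show ?case by (rule exI[of _ "[:0, 1:]"]) (simp add: map_poly_pCons)
next
  case (inverse x)
  then obtain h where h: "x = rpoly h \<beta>" "rpoly h \<beta> \<noteq> 0" by auto
  obtain k where k: "p = gcd p h * k" by (meson dvdE gcd_dvd1)
  \<comment> \<open>A nonconstant gcd would be \<open>p\<close> up to a constant factor, hence
    vanish at \<open>\<beta>\<close> and force \<open>h\<close> to vanish there.\<close>
  have "degree (gcd p h) = 0"
  proof (rule ccontr)
    assume "degree (gcd p h) \<noteq> 0"
    then have "degree k = 0" using min_poly_factor[OF p k] by simp
    then obtain c where c: "k = [:c:]" by (metis degree_0_id)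
    have "rpoly (gcd p h) \<beta> = 0"
      using is_min_poly_rootD[OF p] is_min_poly_neq_0[OF p] k c
      by (metis map_poly_of_rat_eq_0_iff mult_eq_0_iff of_rat_eq_0_iff rpoly_mult rpoly_pCons
          map_poly_0 poly_0 mult_zero_right add_0_right pCons_0_0)
    moreover obtain m where "h = gcd p h * m" by (meson dvdE gcd_dvd2)
    ultimately show False using h(2) by (metis mult_zero_left rpoly_mult)
  qed
  then obtain c where c: "gcd p h = [:c:]" by (metis degree_0_id)
  obtain u v where "u * p + v * h = gcd p h"
    using bezout_coefficients_fst_snd by blast
  then have "rpoly (u * p + v * h) \<beta> = of_rat c" by (simp add: c map_poly_pCons)
  then have vx: "rpoly v \<beta> * x = of_rat c"
    using is_min_poly_rootD[OF p] by (simp add: rpoly_simps h)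
  have "c \<noteq> 0" using c is_min_poly_neq_0[OF p] by auto
  have "x * rpoly (smult (inverse c) v) \<beta> = inverse (of_rat c) * (rpoly v \<beta> * x)"
    by (simp add: rpoly_smult of_rat_inverse mult_ac)
  also have "\<dots> = 1" using \<open>c \<noteq> 0\<close> by (simp add: vx)
  finally have "inverse x = rpoly (smult (inverse c) v) \<beta>" by (rule inverse_unique)
  then show ?case ..
qed (use rpoly_simps in \<open>metis\<close>)+

section \<open>Representations as orbits\<close>

lemma eventually_periodic_range:
  fixes X :: "nat \<Rightarrow> 'a"
  assumes "p > 0" "\<And>n. n \<ge> N \<Longrightarrow> X (n + p) = X n"
  shows "X n \<in> X ` {..<N + p}"
proof (induction n rule: less_induct)
  case (less n)
  show ?case
  proof (cases "n < N + p")
    case False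
    then have "X n = X (n - p)" using assms(2)[of "n - p"] by simp
    then show ?thesis using less[of "n - p"] False assms(1) by simp
  qed simp
qed

text \<open>Natural powers of the inverse replace integer powers of \<open>\<beta>\<close>; the term
  with index \<open>n\<close> carries the digit at position \<open>n + 1\<close>.\<close>

lemma is_representation_iff:
  "is_representation \<beta> A (-1) a x \<longleftrightarrow>
    (\<forall>i \<ge> 1. a i \<in> A) \<and> (\<lambda>n. a (int n + 1) * inverse \<beta> ^ Suc n) sums x"
proof -
  have "(\<lambda>n. a (int n - - 1) * \<beta> powi - (int n - - 1)) =
      (\<lambda>n. a (int n + 1) * inverse \<beta> ^ Suc n)"
  proof
    fix n
    have "\<beta> powi - (int n - - 1) = \<beta> powi - int (Suc n)" by (simp add: algebra_simps)
    also have "\<dots> = inverse \<beta> ^ Suc n"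
      unfolding power_int_minus power_int_of_nat power_inverse ..
    finally show "a (int n - - 1) * \<beta> powi - (int n - - 1) = a (int n + 1) * inverse \<beta> ^ Suc n"
      by simp
  qed
  then show ?thesis unfolding is_representation_def minus_minus by metis
qed

text \<open>The orbit consists of the tails of the series, each rescaled by a power of
  \<open>\<beta>\<close> to start at position 1. Tails of an eventually periodic digit sequence
  repeat.\<close>

lemma ep_representation_imp_orbit:
  assumes \<beta>: "norm \<beta> > 1" and A: "finite A"
    and rep: "is_representation \<beta> A (-1) a x" and ep: "eventually_periodic a"
  obtains X N p where "X 0 = x" "\<And>n. \<beta> * X n - X (Suc n) \<in> A"
    "p > (0::nat)" "X (N + p) = X (N::nat)"
proof -
  define b where "b n = a (int n + 1)" for n
  define \<gamma> where "\<gamma> = inverse \<beta>"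
  have \<beta>0: "\<beta> \<noteq> 0" using \<beta> by auto
  have \<gamma>: "norm \<gamma> < 1" "\<beta> * \<gamma> = 1"
    using \<beta> \<beta>0 by (auto simp: \<gamma>_def norm_inverse inverse_less_1_iff)
  have bA: "b n \<in> A" for n using rep by (simp add: is_representation_iff b_def)
  have sums: "(\<lambda>n. b n * \<gamma> ^ Suc n) sums x"
    using rep unfolding is_representation_iff b_def \<gamma>_def ..
  obtain M where M: "\<And>y. y \<in> A \<Longrightarrow> norm y \<le> M"
    using finite_imp_bounded[OF A] by (auto simp: bounded_iff)
  have summ: "summable (\<lambda>i. b (n + i) * \<gamma> ^ Suc i)" for n
  proof (rule summable_comparison_test')
    show "summable (\<lambda>i. M * norm \<gamma> ^ Suc i)"
      using \<gamma> by (intro summable_mult) (simp add: summable_geometric)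
    show "norm (b (n + i) * \<gamma> ^ Suc i) \<le> M * norm \<gamma> ^ Suc i" for i
      unfolding norm_mult norm_power by (intro mult_right_mono M bA) simp
  qed
  define X where "X n = (\<Sum>i. b (n + i) * \<gamma> ^ Suc i)" for n
  have "X 0 = x" using sums by (simp add: X_def sums_iff)
  moreover have "\<beta> * X n - X (Suc n) = b n" for n
  proof -
    have "\<gamma> * X (Suc n) = (\<Sum>i. \<gamma> * (b (Suc n + i) * \<gamma> ^ Suc i))"
      unfolding X_def by (rule suminf_mult[OF summ, symmetric])
    also have "\<dots> = (\<Sum>i. b (n + Suc i) * \<gamma> ^ Suc (Suc i))"
      by (simp add: mult_ac)
    also have "\<dots> = X n - b n * \<gamma>"
      unfolding X_def using suminf_split_head[OF summ[of n]] by simp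
    finally have eq: "\<gamma> * X (Suc n) = X n - b n * \<gamma>" .
    have "\<beta> * X n - (\<beta> * \<gamma>) * X (Suc n) = \<beta> * X n - \<beta> * (X n - b n * \<gamma>)"
      by (simp only: mult.assoc eq)
    also have "\<dots> = (\<beta> * \<gamma>) * b n" by (simp add: algebra_simps)
    finally show ?thesis using \<gamma>(2) by simp
  qed
  moreover obtain N p where Np: "p > (0::int)" "\<And>i. i \<ge> N \<Longrightarrow> a (i + p) = a i"
    using ep by (auto simp: eventually_periodic_def)
  \<comment> \<open>The threshold \<open>N\<close> may be negative; from \<open>nat N\<close> on,
    all positions \<open>nat N + i + 1\<close> are at least \<open>N\<close>.\<close>
  have "b (nat N + nat p + i) = b (nat N + i)" for i
  proof -
    have "b (nat N + nat p + i) = a (int (nat N + i) + 1 + p)"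
      using Np(1) by (simp add: b_def algebra_simps)
    also have "\<dots> = b (nat N + i)" unfolding b_def by (rule Np(2)) linarith
    finally show ?thesis .
  qed
  then have "X (nat N + nat p) = X (nat N)" by (simp add: X_def)
  ultimately show ?thesis using that[of X "nat p" "nat N"] bA Np(1) by simp
qed

text \<open>The partial sums telescope to \<open>X 0 - \<gamma> ^ n * X n\<close>. An eventually
  periodic orbit has finite range, so it is bounded and the remainder tends to 0.\<close>

lemma orbit_imp_ep_representation:
  assumes \<beta>: "norm \<beta> > 1" and X: "\<And>n. \<beta> * X n - X (Suc n) \<in> A"
    and p: "p > (0::nat)" "\<And>n. n \<ge> N \<Longrightarrow> X (n + p) = X n"
  shows "\<exists>a. is_representation \<beta> A (-1) a (X 0) \<and> eventually_periodic a"
proof -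
  define a where "a i = \<beta> * X (nat (i - 1)) - X (nat i)" for i :: int
  define \<gamma> where "\<gamma> = inverse \<beta>"
  have \<beta>0: "\<beta> \<noteq> 0" using \<beta> by auto
  have \<gamma>: "norm \<gamma> < 1" "\<beta> * \<gamma> = 1"
    using \<beta> \<beta>0 by (auto simp: \<gamma>_def norm_inverse inverse_less_1_iff)
  have a: "a (int n + 1) = \<beta> * X n - X (Suc n)" for n
  proof -
    have "nat (int n + 1) = Suc n" by simp
    then show ?thesis by (simp add: a_def)
  qed
  have "a i \<in> A" if "i \<ge> 1" for i
    using a[of "nat (i - 1)"] X[of "nat (i - 1)"] that by simp
  moreover have "(\<lambda>n. a (int n + 1) * \<gamma> ^ Suc n) sums X 0"
  proof -
    have "(\<Sum>k<n. a (int k + 1) * \<gamma> ^ Suc k) = X 0 - \<gamma> ^ n * X n" for n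
    proof (induction n)
      case (Suc n)
      have "a (int n + 1) * \<gamma> ^ Suc n = (\<beta> * \<gamma>) * \<gamma> ^ n * X n - \<gamma> ^ Suc n * X (Suc n)"
        unfolding a by (simp add: algebra_simps)
      then show ?case using Suc \<gamma>(2) by simp
    qed simp
    moreover have "(\<lambda>n. X 0 - \<gamma> ^ n * X n) \<longlonglongrightarrow> X 0 - 0"
    proof (intro tendsto_diff tendsto_const)
      have "range X \<subseteq> X ` {..<N + p}" using eventually_periodic_range[of p N X] p by blast
      then have "bounded (range X)" by (meson bounded_subset finite_imageI finite_imp_bounded finite_lessThan)
      then obtain M where M: "\<And>n. norm (X n) \<le> M" by (auto simp: bounded_iff)
      show "(\<lambda>n. \<gamma> ^ n * X n) \<longlonglongrightarrow> 0"
      proof (rule Lim_null_comparison)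
        show "\<forall>\<^sub>F n in sequentially. norm (\<gamma> ^ n * X n) \<le> norm \<gamma> ^ n * M"
          by (intro always_eventually allI) (simp add: norm_mult norm_power M mult_left_mono)
        show "(\<lambda>n. norm \<gamma> ^ n * M) \<longlonglongrightarrow> 0"
          using \<gamma>(1) by (intro tendsto_mult_left_zero LIMSEQ_power_zero) simp
      qed
    qed
    ultimately show ?thesis by (simp add: sums_def)
  qed
  ultimately have "is_representation \<beta> A (-1) a (X 0)"
    unfolding is_representation_iff \<gamma>_def by blast
  \<comment> \<open>The digit at position \<open>i\<close> involves \<open>X (i - 1)\<close>, so its
    periodicity starts one place after that of \<open>X\<close>.\<close>
  moreover have "a (i + int p) = a i" if "i \<ge> int N + 1" for i
  proof -
    have "nat (i + int p - 1) = nat (i - 1) + p" "nat (i + int p) = nat i + p"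
      using that by auto
    then show ?thesis using p(2)[of "nat (i - 1)"] p(2)[of "nat i"] that by (simp add: a_def)
  qed
  then have "eventually_periodic a"
    unfolding eventually_periodic_def using p(1)
    by (intro exI[of _ "int N + 1"] exI[of _ "int p"]) simp
  ultimately show ?thesis by blast
qed

section \<open>Necessity\<close>

text \<open>Fractions over \<open>\<int>[1 / \<beta>]\<close> also cover transcendental
  \<open>\<beta>\<close>, which necessity has to exclude.\<close>

lemma rat_adjoin_eq_quotient:
  assumes "\<beta> \<noteq> 0" "x \<in> rat_adjoin \<beta>"
  shows "\<exists>u v. ipoly v (inverse \<beta>) \<noteq> 0 \<and> x = ipoly u (inverse \<beta>) / ipoly v (inverse \<beta>)"
  using assms(2)
proof induction
  case one
  show ?case by (rule exI[of _ 1], rule exI[of _ 1]) simp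
next
  case gen
  show ?case
    by (rule exI[of _ 1], rule exI[of _ "[:0, 1:]"])
      (use assms(1) in \<open>simp add: map_poly_pCons field_simps\<close>)
next
  case (add x y)
  then obtain u v u' v' where
    "ipoly v (inverse \<beta>) \<noteq> 0" "x = ipoly u (inverse \<beta>) / ipoly v (inverse \<beta>)"
    "ipoly v' (inverse \<beta>) \<noteq> 0" "y = ipoly u' (inverse \<beta>) / ipoly v' (inverse \<beta>)" by blast
  then show ?case
    by (intro exI[of _ "u * v' + u' * v"] exI[of _ "v * v'"])
      (simp add: ipoly_simps add_frac_eq)
next
  case (uminus x)
  then obtain u v where
    "ipoly v (inverse \<beta>) \<noteq> 0" "x = ipoly u (inverse \<beta>) / ipoly v (inverse \<beta>)" by blast
  then show ?case by (intro exI[of _ "- u"] exI[of _ v]) (simp add: ipoly_simps)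
next
  case (mult x y)
  then obtain u v u' v' where
    "ipoly v (inverse \<beta>) \<noteq> 0" "x = ipoly u (inverse \<beta>) / ipoly v (inverse \<beta>)"
    "ipoly v' (inverse \<beta>) \<noteq> 0" "y = ipoly u' (inverse \<beta>) / ipoly v' (inverse \<beta>)" by blast
  then show ?case
    by (intro exI[of _ "u * u'"] exI[of _ "v * v'"]) (simp add: ipoly_simps)
next
  case (inverse x)
  then obtain u v where
    "ipoly v (inverse \<beta>) \<noteq> 0" "x = ipoly u (inverse \<beta>) / ipoly v (inverse \<beta>)" by blast
  then show ?case using inverse.hyps by (intro exI[of _ v] exI[of _ u]) auto
qed

text \<open>A product of denominators of the individual elements works. It moves all digits into the
  ring \<open>\<int>[1 / \<beta>]\<close>.\<close>

lemma common_denominator: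
  assumes "\<beta> \<noteq> 0" "finite A" "A \<subseteq> rat_adjoin \<beta>"
  shows "\<exists>v. ipoly v (inverse \<beta>) \<noteq> 0 \<and>
    (\<forall>a\<in>A. \<exists>u. ipoly v (inverse \<beta>) * a = ipoly u (inverse \<beta>))"
  using assms(2,3)
proof (induction A)
  case empty
  show ?case by (rule exI[of _ 1]) simp
next
  case (insert b A)
  obtain v where v: "ipoly v (inverse \<beta>) \<noteq> 0"
    "\<And>a. a \<in> A \<Longrightarrow> \<exists>u. ipoly v (inverse \<beta>) * a = ipoly u (inverse \<beta>)"
    using insert by blast
  obtain u' v' where b: "ipoly v' (inverse \<beta>) \<noteq> 0"
    "b = ipoly u' (inverse \<beta>) / ipoly v' (inverse \<beta>)"
    using rat_adjoin_eq_quotient[of \<beta> b] insert assms(1) by blast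
  have "\<exists>u. ipoly (v' * v) (inverse \<beta>) * a = ipoly u (inverse \<beta>)" if a: "a \<in> insert b A" for a
  proof (cases "a = b")
    case True
    then show ?thesis using b by (intro exI[of _ "v * u'"]) (simp add: ipoly_simps)
  next
    case False
    then obtain u where "ipoly v (inverse \<beta>) * a = ipoly u (inverse \<beta>)" using v(2) a by blast
    then show ?thesis by (intro exI[of _ "v' * u"]) (simp add: ipoly_simps mult.assoc)
  qed
  then show ?case using v(1) b(1) by (intro exI[of _ "v' * v"]) (simp add: ipoly_simps)
qed

text \<open>Multiplying \<open>\<beta> = g(1 / \<beta>)\<close> by \<open>\<beta> ^ degree g\<close>
  gives a monic equation: the reflected polynomial has degree at most \<open>degree g\<close>, below
  the monomial \<open>\<beta> ^ (degree g + 1)\<close>.\<close>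

lemma algebraic_int_of_inverse:
  assumes "\<beta> \<noteq> 0" "\<beta> = ipoly g (inverse \<beta>)"
  shows "algebraic_int \<beta>"
proof -
  let ?G = "map_poly of_int g :: complex poly"
  define f where "f = monom 1 (Suc (degree ?G)) - reflect_poly ?G"
  have le: "degree (reflect_poly ?G) \<le> degree ?G" by (rule degree_reflect_poly_le)
  then have z: "coeff (reflect_poly ?G) n = 0" if "n > degree ?G" for n
    using that by (intro coeff_eq_0) simp
  have deg: "degree f = Suc (degree ?G)"
    by (rule antisym, rule degree_le) (auto simp: f_def z intro!: le_degree)
  show ?thesis
  proof (rule algebraic_int.intros)
    show "lead_coeff f = 1" by (simp add: deg) (simp add: f_def z)
    show "\<forall>i. coeff f i \<in> \<int>"
      by (auto simp: f_def coeff_reflect_poly coeff_map_poly)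
    show "poly f \<beta> = 0"
      using assms by (simp add: f_def poly_monom poly_reflect_poly_nz)
  qed
qed

lemma weak_greedy_imp_algebraic_int:
  assumes \<beta>: "norm \<beta> > 1" and A: "finite A" "A \<subseteq> rat_adjoin \<beta>"
    and wg: "admits_weak_greedy_ep \<beta> A"
  shows "algebraic_int \<beta>"
proof -
  define \<gamma> where "\<gamma> = inverse \<beta>"
  have \<beta>0: "\<beta> \<noteq> 0" using \<beta> by auto
  have \<gamma>: "\<beta> * \<gamma> = 1" using \<beta>0 by (simp add: \<gamma>_def)
  obtain c where c: "c > 0" "\<And>x. x \<in> rat_adjoin \<beta> \<Longrightarrow> norm x < c \<Longrightarrow>
      \<exists>a. is_representation \<beta> A (-1) a x \<and> eventually_periodic a"
    using wg by (auto simp: admits_weak_greedy_ep_def)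
  obtain v where v: "ipoly v \<gamma> \<noteq> 0" "\<And>a. a \<in> A \<Longrightarrow> \<exists>u. ipoly v \<gamma> * a = ipoly u \<gamma>"
    using common_denominator[OF \<beta>0 A] unfolding \<gamma>_def by blast
  define D where "D = ipoly v \<gamma>"
  obtain k :: nat where k: "k > 0" "1 / (norm D * c) < of_nat k"
    by (metis gr_zeroI linorder_not_less of_nat_0 order_less_le_trans reals_Archimedean2 c(1)
        norm_ge_zero zero_le_divide_1_iff zero_le_mult_iff less_eq_real_def)
  \<comment> \<open>With \<open>D\<close> in the denominator, \<open>D * X 0\<close> becomes
    \<open>1 / k\<close>; the size of \<open>k\<close> makes \<open>x\<close> smaller than
    \<open>c\<close>.\<close>
  define x where "x = 1 / (D * of_nat k)"
  have "D \<noteq> 0" using v(1) by (simp add: D_def)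
  have "norm x < c"
    using k c(1) \<open>D \<noteq> 0\<close> by (simp add: x_def norm_divide norm_mult field_simps)
  moreover have "x \<in> rat_adjoin \<beta>"
    unfolding x_def D_def \<gamma>_def
    by (intro rat_adjoin_divide rat_adjoin.mult rat_adjoin_ipoly rat_adjoin.inverse
        rat_adjoin.gen rat_adjoin.one \<beta>0) (use rat_adjoin_of_int[of "int k"] in simp)
  ultimately obtain X N p where X: "X 0 = x" "\<And>n. \<beta> * X n - X (Suc n) \<in> A"
      "p > 0" "X (N + p) = X N"
    using c(2) ep_representation_imp_orbit[OF \<beta> A(1)] by metis
  \<comment> \<open>The difference is the partial sum of the first \<open>n\<close> digits. Its
    terms start at \<open>\<gamma>\<close>, so after multiplication by \<open>D\<close> a factor
    \<open>\<gamma>\<close> splits off.\<close>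
  have S: "\<exists>u. D * (X 0 - \<gamma> ^ n * X n) = \<gamma> * ipoly u \<gamma>" for n
  proof (induction n)
    case 0
    show ?case by (rule exI[of _ 0]) simp
  next
    case (Suc n)
    then obtain u where u: "D * (X 0 - \<gamma> ^ n * X n) = \<gamma> * ipoly u \<gamma>" by blast
    obtain w where w: "D * (\<beta> * X n - X (Suc n)) = ipoly w \<gamma>"
      using v(2)[OF X(2)] unfolding D_def by blast
    have "D * (X 0 - \<gamma> ^ Suc n * X (Suc n)) =
        D * (X 0 - \<gamma> ^ n * X n) + \<gamma> ^ Suc n * (D * (\<beta> * X n - X (Suc n))) +
        D * \<gamma> ^ n * X n * (1 - \<beta> * \<gamma>)"
      by (simp add: algebra_simps)
    also have "\<dots> = \<gamma> * ipoly (u + monom 1 n * w) \<gamma>"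
      unfolding u w using \<gamma> by (simp add: ipoly_simps map_poly_monom poly_monom algebra_simps)
    finally show ?case ..
  qed
  obtain u w where u: "D * (X 0 - \<gamma> ^ (N + p) * X (N + p)) = \<gamma> * ipoly u \<gamma>"
    and w: "D * (X 0 - \<gamma> ^ N * X N) = \<gamma> * ipoly w \<gamma>"
    using S by blast
  \<comment> \<open>Subtracting \<open>\<gamma> ^ p\<close> times the relation at \<open>N\<close>
    from that at \<open>N + p\<close> removes the unknown \<open>X N\<close>.\<close>
  have "D * X 0 * (1 - \<gamma> ^ p) = D * (X 0 - \<gamma> ^ (N + p) * X (N + p)) - \<gamma> ^ p * (D * (X 0 - \<gamma> ^ N * X N))"
    unfolding X(4) by (simp add: algebra_simps power_add)
  then have "D * X 0 * (1 - \<gamma> ^ p) = \<gamma> * ipoly (u - monom 1 p * w) \<gamma>"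
    unfolding u w by (simp add: ipoly_simps map_poly_monom poly_monom algebra_simps)
  moreover have "of_nat k * (D * X 0) = 1" using \<open>D \<noteq> 0\<close> k(1) by (simp add: X x_def)
  ultimately have "1 - \<gamma> ^ p = of_nat k * (\<gamma> * ipoly (u - monom 1 p * w) \<gamma>)"
    by (metis mult.assoc mult_1)
  \<comment> \<open>As \<open>p > 0\<close>, also \<open>\<gamma> ^ p\<close> is a multiple of
    \<open>\<gamma>\<close>, so 1 itself is \<open>\<gamma>\<close> times an element of
    \<open>\<int>[\<gamma>]\<close>; multiplying by \<open>\<beta>\<close> puts
    \<open>\<beta>\<close> into that ring.\<close>
  moreover have "\<gamma> ^ p = \<gamma> * \<gamma> ^ (p - 1)" using X(3) by (cases p) auto
  ultimately have "1 = \<gamma> * ipoly (smult (int k) (u - monom 1 p * w) + monom 1 (p - 1)) \<gamma>"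
    by (simp add: ipoly_add ipoly_smult map_poly_monom poly_monom algebra_simps)
  then have "\<beta> * 1 = (\<beta> * \<gamma>) * ipoly (smult (int k) (u - monom 1 p * w) + monom 1 (p - 1)) \<gamma>"
    by (simp only: mult.assoc)
  then show ?thesis using \<gamma> \<beta>0 unfolding \<gamma>_def by (intro algebraic_int_of_inverse) simp_all
qed

section \<open>Conjugates outside the unit disc\<close>

text \<open>The real quadratic with roots \<open>x\<close> and \<open>cnj x\<close> is nonzero at
  \<open>y\<close>. A large multiple is large at \<open>y\<close> and 0 at \<open>x\<close>;
  rational approximation of its coefficients changes both values only slightly.\<close>

lemma rpoly_small_and_large:
  assumes "y \<noteq> x" "y \<noteq> cnj x" "c > 0"
  obtains h where "norm (rpoly h x) < c" "norm (rpoly h y) > C"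
proof -
  define q where "q z = (z - x) * (z - cnj x)" for z
  have "norm (q y) > 0" using assms by (simp add: q_def)
  then obtain k :: nat where "(\<bar>C\<bar> + 1) / norm (q y) < of_nat k" using reals_Archimedean2 by blast
  then have k: "\<bar>C\<bar> + 1 < of_nat k * norm (q y)"
    using \<open>norm (q y) > 0\<close> by (simp add: field_simps)
  have k0: "k > 0" using k by (intro gr0I) auto
  \<comment> \<open>Coefficient errors up to \<open>e\<close> change the value at \<open>z\<close>
    by at most \<open>k * e * (norm z + 1)\<close>, which stays below \<open>min c 1\<close> when
    \<open>norm z \<le> norm x + norm y\<close>.\<close>
  define e where "e = min c 1 / (of_nat k * (norm x + norm y + 2))"
  have nn: "norm x + norm y + 2 > 0" by (smt (verit) norm_ge_zero)
  have e: "e > 0" using assms(3) k0 nn by (simp add: e_def)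
  obtain r where r: "2 * Re x < of_rat r" "of_rat r < 2 * Re x + e"
    using of_rat_dense[of "2 * Re x" "2 * Re x + e"] e by auto
  obtain s where s: "(norm x)\<^sup>2 < of_rat s" "of_rat s < (norm x)\<^sup>2 + e"
    using of_rat_dense[of "(norm x)\<^sup>2" "(norm x)\<^sup>2 + e"] e by auto
  define h where "h = smult (of_nat k) [:s, - r, 1:]"
  have cr: "of_rat t = complex_of_real (of_rat t)" for t
    by (cases t rule: Rat_cases) (simp add: of_rat_rat)
  have err: "norm (rpoly h z - of_nat k * q z) < min c 1" if z: "norm z \<le> norm x + norm y" for z
  proof -
    have xx: "x * cnj x = of_real ((norm x)\<^sup>2)" "x + cnj x = of_real (2 * Re x)"
      by (rule complex_norm_square[symmetric], rule complex_add_cnj)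
    have qz: "q z = z * z - (x + cnj x) * z + x * cnj x" by (simp add: q_def algebra_simps)
    have hz: "rpoly h z = of_nat k * (of_real (of_rat s) - of_real (of_rat r) * z + z * z)"
      unfolding h_def rpoly_smult
      by (simp add: map_poly_pCons of_rat_minus cr[of r] cr[of s] algebra_simps)
    have "rpoly h z - of_nat k * q z =
        of_nat k * (of_real (2 * Re x - of_rat r) * z + of_real (of_rat s - (norm x)\<^sup>2))"
      unfolding hz qz xx by (simp add: algebra_simps)
    then have "norm (rpoly h z - of_nat k * q z) \<le>
        of_nat k * (\<bar>2 * Re x - of_rat r\<bar> * norm z + \<bar>of_rat s - (norm x)\<^sup>2\<bar>)"
      by (simp only: norm_mult norm_of_nat)
        (metis mult_left_mono norm_mult norm_of_real norm_triangle_ineq of_nat_0_le_iff)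
    also have "\<dots> \<le> of_nat k * (e * norm z + e)"
      using r s by (intro mult_left_mono add_mono mult_right_mono) auto
    also have "\<dots> = of_nat k * e * (norm z + 1)" by (simp add: algebra_simps)
    also have "\<dots> < of_nat k * e * (norm x + norm y + 2)"
      using z k0 e by (intro mult_strict_left_mono) auto
    also have "\<dots> = min c 1" using k0 nn by (simp add: e_def)
    finally show ?thesis .
  qed
  have "norm (rpoly h x) < c" using err[of x] by (simp add: q_def)
  moreover have "norm (rpoly h y) > C"
  proof -
    have "norm (of_nat k * q y) \<le> norm (rpoly h y) + norm (rpoly h y - of_nat k * q y)"
      by (metis norm_minus_commute norm_triangle_sub)
    moreover have "norm (rpoly h y - of_nat k * q y) < 1" using err[of y] by simp
    ultimately show ?thesis using k unfolding norm_mult norm_of_nat by linarith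
  qed
  ultimately show ?thesis by (rule that)
qed

text \<open>Above \<open>M / (norm y - 1)\<close>, multiplication by \<open>y\<close> gains more
  than a digit of norm at most \<open>M\<close> can take away, so a conjugate orbit that starts
  there never repeats.\<close>

lemma weak_greedy_imp_conjugates:
  assumes \<beta>: "norm \<beta> > 1" and A: "finite A" "A \<subseteq> rat_adjoin \<beta>"
    and wg: "admits_weak_greedy_ep \<beta> A"
    and p: "is_min_poly p \<beta>" and y: "rpoly p y = 0" "norm y > 1"
  shows "y = \<beta> \<or> y = cnj \<beta>"
proof (rule ccontr)
  assume "\<not> (y = \<beta> \<or> y = cnj \<beta>)"
  then have ne: "y \<noteq> \<beta>" "y \<noteq> cnj \<beta>" by auto
  obtain c where c: "c > 0" "\<And>x. x \<in> rat_adjoin \<beta> \<Longrightarrow> norm x < c \<Longrightarrow>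
      \<exists>a. is_representation \<beta> A (-1) a x \<and> eventually_periodic a"
    using wg by (auto simp: admits_weak_greedy_ep_def)
  have "\<forall>a\<in>A. \<exists>h. a = rpoly h \<beta>" using rat_adjoin_eq_rpoly[OF p] A(2) by blast
  then obtain d where d: "\<And>a. a \<in> A \<Longrightarrow> rpoly (d a) \<beta> = a" by metis
  obtain M where M: "\<And>a. a \<in> A \<Longrightarrow> norm (rpoly (d a) y) \<le> M"
    using finite_imp_bounded[OF finite_imageI[OF A(1), of "\<lambda>a. rpoly (d a) y"]]
    by (auto simp: bounded_iff)
  obtain h where h: "norm (rpoly h \<beta>) < c" "norm (rpoly h y) > M / (norm y - 1)"
    using rpoly_small_and_large[OF ne c(1)] by metis
  obtain X N q where X: "X 0 = rpoly h \<beta>" "\<And>n. \<beta> * X n - X (Suc n) \<in> A"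
      "q > 0" "X (N + q) = X N"
    using c(2)[OF rat_adjoin_rpoly[OF rat_adjoin.gen] h(1)]
      ep_representation_imp_orbit[OF \<beta> A(1)] by metis
  \<comment> \<open>The orbit is lifted to polynomials: \<open>H n\<close> has the value
    \<open>X n\<close> at \<open>\<beta>\<close> and the conjugate state at
    \<open>y\<close>.\<close>
  define H where "H = rec_nat h (\<lambda>n g. pCons 0 g - d (\<beta> * X n - X (Suc n)))"
  have H: "H 0 = h" "\<And>n. H (Suc n) = pCons 0 (H n) - d (\<beta> * X n - X (Suc n))"
    by (simp_all add: H_def)
  have HX: "rpoly (H n) \<beta> = X n" for n
    by (induction n) (simp_all add: H X d rpoly_simps)
  have step: "norm (rpoly (H n) y) < norm (rpoly (H (Suc n)) y)"
    if "norm (rpoly (H n) y) > M / (norm y - 1)" for n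
  proof -
    have "norm (y * rpoly (H n) y) \<le>
        norm (rpoly (H (Suc n)) y) + norm (rpoly (d (\<beta> * X n - X (Suc n))) y)"
      using norm_triangle_ineq[of "rpoly (H (Suc n)) y" "rpoly (d (\<beta> * X n - X (Suc n))) y"]
      by (simp add: H rpoly_simps)
    moreover have "norm (rpoly (H n) y) * (norm y - 1) > M"
      using that y(2) by (simp add: field_simps)
    ultimately show ?thesis using M[OF X(2)[of n]] by (simp add: norm_mult algebra_simps)
  qed
  have big: "norm (rpoly (H n) y) > M / (norm y - 1)" for n
    by (induction n) (use h step in \<open>auto simp: H(1) intro: less_trans\<close>)
  have "norm (rpoly (H N) y) < norm (rpoly (H (N + q)) y)"
    using lift_Suc_mono_less[of "\<lambda>n. norm (rpoly (H n) y)" N "N + q"] step big X(3) by simp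
  moreover have "rpoly (H (N + q) - H N) y = 0"
    by (rule is_min_poly_transfer[OF p y(1)]) (simp add: rpoly_simps HX X)
  ultimately show False by (simp add: rpoly_simps)
qed

section \<open>Sufficiency\<close>

text \<open>Newton's scheme: a multiple of the polynomial vanishing on the old points corrects the
  value at the new one.\<close>

lemma interpolation:
  fixes Z :: "complex set" and y :: "complex \<Rightarrow> complex"
  assumes "finite Z" "Z \<noteq> {}"
  shows "\<exists>q. degree q < card Z \<and> (\<forall>z\<in>Z. poly q z = y z)"
  using assms
proof (induction rule: finite_ne_induct)
  case (singleton z)
  show ?case by (rule exI[of _ "[:y z:]"]) simp
next
  case (insert w Z)
  then obtain q where q: "degree q < card Z" "\<And>z. z \<in> Z \<Longrightarrow> poly q z = y z" by blast
  define m where "m = (\<Prod>z\<in>Z. [:- z, 1:])"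
  have m: "poly m z = (\<Prod>v\<in>Z. z - v)" for z by (simp add: m_def poly_prod)
  have mw: "poly m w \<noteq> 0" using insert by (auto simp: m)
  have dm: "degree m = card Z" by (simp add: m_def degree_prod_eq_sum_degree)
  define r where "r = q + smult ((y w - poly q w) / poly m w) m"
  have "degree r \<le> card Z"
    unfolding r_def using q(1) dm by (intro degree_add_le order.trans[OF degree_smult_le]) auto
  moreover have "poly r z = y z" if "z \<in> insert w Z" for z
  proof (cases "z = w")
    case True
    then show ?thesis using mw by (simp add: r_def)
  next
    case False
    then have "poly m z = 0" using that insert.hyps(1) by (auto simp: m)
    then show ?thesis using that False q(2) by (simp add: r_def)
  qed
  ultimately show ?case using insert.hyps by (intro exI[of _ r]) auto
qed

text \<open>Values on a set closed under conjugation are interpolated by a real polynomial: average a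
  complex interpolant with its conjugate. Rounding the coefficients gives an integer polynomial.\<close>

lemma integer_interpolation_approx:
  fixes Z :: "complex set"
  assumes Z: "finite Z" "Z \<noteq> {}" and cnjZ: "\<And>z. z \<in> Z \<Longrightarrow> cnj z \<in> Z"
  obtains R where "R > 0"
    "\<And>y. (\<And>z. z \<in> Z \<Longrightarrow> y (cnj z) = cnj (y z)) \<Longrightarrow>
       \<exists>a. degree a < card Z \<and> (\<forall>z\<in>Z. norm (ipoly a z - y z) \<le> R)"
proof -
  obtain B where B: "\<And>z. z \<in> Z \<Longrightarrow> norm z \<le> B" "B > 0"
    using finite_imp_bounded[OF Z(1)] by (auto simp: bounded_pos)
  \<comment> \<open>Rounding down moves a coefficient by at most 1, hence the values on
    \<open>Z\<close> by at most \<open>B ^ i\<close>. The final 1 makes positivity evident.\<close>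
  define R where "R = (\<Sum>i<card Z. B ^ i) + 1"
  have "R > 0" using B(2) by (auto simp: R_def intro!: add_nonneg_pos sum_nonneg)
  moreover have "\<exists>a. degree a < card Z \<and> (\<forall>z\<in>Z. norm (ipoly a z - y z) \<le> R)"
    if y: "\<And>z. z \<in> Z \<Longrightarrow> y (cnj z) = cnj (y z)" for y
  proof -
    obtain q where q: "degree q < card Z" "\<And>z. z \<in> Z \<Longrightarrow> poly q z = y z"
      using interpolation[OF Z] by blast
    define t where "t i = Re (coeff q i)" for i
    define a where "a = (\<Sum>i<card Z. monom \<lfloor>t i\<rfloor> i)"
    have card: "card Z > 0" using Z by (simp add: card_gt_0_iff)
    have poly_q: "poly q z = (\<Sum>i<card Z. coeff q i * z ^ i)" for z
    proof -
      have "poly q z = (\<Sum>i\<le>degree q. coeff q i * z ^ i)" by (rule poly_altdef)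
      also have "\<dots> = (\<Sum>i<card Z. coeff q i * z ^ i)"
        using q(1) by (intro sum.mono_neutral_left) (auto simp: coeff_eq_0)
      finally show ?thesis .
    qed
    have yt: "y z = (\<Sum>i<card Z. of_real (t i) * z ^ i)" if z: "z \<in> Z" for z
    proof -
      have "y z = (poly q z + cnj (poly q (cnj z))) / 2"
        using q(2) cnjZ[OF z] y[OF z] z by simp
      also have "\<dots> = (\<Sum>i<card Z. ((coeff q i + cnj (coeff q i)) / 2) * z ^ i)"
        unfolding poly_q by (simp add: sum.distrib sum_divide_distrib algebra_simps add_divide_distrib)
      also have "\<dots> = (\<Sum>i<card Z. of_real (t i) * z ^ i)"
        by (simp add: t_def complex_add_cnj)
      finally show ?thesis .
    qed
    have ca: "coeff a i = (if i < card Z then \<lfloor>t i\<rfloor> else 0)" for i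
      by (simp add: a_def coeff_sum)
    have "degree a \<le> card Z - 1" using card by (intro degree_le) (auto simp: ca)
    then have dega: "degree a < card Z" using card by simp
    have ia: "ipoly a z = (\<Sum>i<card Z. of_int \<lfloor>t i\<rfloor> * z ^ i)" for z
    proof -
      have "ipoly a z = (\<Sum>i\<le>degree a. of_int (coeff a i) * z ^ i)"
        by (simp add: poly_altdef degree_map_poly_of_int coeff_map_poly)
      also have "\<dots> = (\<Sum>i<card Z. of_int (coeff a i) * z ^ i)"
        using dega by (intro sum.mono_neutral_left) (auto simp: coeff_eq_0)
      finally show ?thesis by (simp add: ca)
    qed
    have "norm (ipoly a z - y z) \<le> R" if z: "z \<in> Z" for z
    proof -
      have "norm (ipoly a z - y z) = norm (\<Sum>i<card Z. of_real (of_int \<lfloor>t i\<rfloor> - t i) * z ^ i)"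
        by (simp add: ia yt[OF z] sum_subtractf algebra_simps)
      also have "\<dots> \<le> (\<Sum>i<card Z. B ^ i)"
      proof (rule sum_norm_le)
        fix i
        have "\<bar>of_int \<lfloor>t i\<rfloor> - t i\<bar> \<le> 1" by linarith
        moreover have "norm z ^ i \<le> B ^ i" using B(1)[OF z] by (intro power_mono) auto
        ultimately have "\<bar>of_int \<lfloor>t i\<rfloor> - t i\<bar> * norm z ^ i \<le> 1 * B ^ i"
          by (intro mult_mono) auto
        then show "norm (of_real (of_int \<lfloor>t i\<rfloor> - t i) * z ^ i) \<le> B ^ i"
          by (simp only: norm_mult norm_power norm_of_real mult_1)
      qed
      finally show ?thesis by (simp add: R_def)
    qed
    then show ?thesis using dega by blast
  qed
  ultimately show ?thesis by (rule that)
qed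

lemma finite_bounded_int_polys:
  "finite {h :: int poly. degree h < d \<and> (\<forall>i<d. \<bar>coeff h i\<bar> \<le> C)}"
proof (rule finite_subset)
  show "finite (Poly ` {xs. set xs \<subseteq> {-C..C} \<and> length xs = d})"
    by (intro finite_imageI finite_lists_length_eq) simp
  show "{h. degree h < d \<and> (\<forall>i<d. \<bar>coeff h i\<bar> \<le> C)} \<subseteq>
      Poly ` {xs. set xs \<subseteq> {-C..C} \<and> length xs = d}"
  proof
    fix h :: "int poly" assume h: "h \<in> {h. degree h < d \<and> (\<forall>i<d. \<bar>coeff h i\<bar> \<le> C)}"
    have "h = Poly (map (coeff h) [0..<d])"
      using h by (intro poly_eqI) (auto simp: nth_default_def coeff_eq_0)
    moreover have "set (map (coeff h) [0..<d]) \<subseteq> {-C..C}"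
    proof
      fix c assume "c \<in> set (map (coeff h) [0..<d])"
      then obtain i where "i < d" "c = coeff h i" by auto
      then have "\<bar>c\<bar> \<le> C" using h by blast
      then show "c \<in> {-C..C}" by (simp add: abs_le_iff)
    qed
    ultimately show "h \<in> Poly ` {xs. set xs \<subseteq> {-C..C} \<and> length xs = d}" by force
  qed
qed

text \<open>Lagrange interpolation expresses the coefficients as fixed linear combinations of the
  values on \<open>Z\<close>, so bounded values leave finitely many integer coefficients.\<close>

lemma finite_int_polys_bounded_values:
  fixes Z :: "complex set"
  assumes Z: "finite Z" "Z \<noteq> {}"
  shows "finite {h :: int poly. degree h < card Z \<and> (\<forall>z\<in>Z. norm (ipoly h z) \<le> B)}"
proof -
  have "\<exists>q. degree q < card Z \<and> (\<forall>z\<in>Z. poly q z = (if z = w then 1 else 0))" for w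
    using interpolation[OF Z, of "\<lambda>z. if z = w then 1 else 0"] by blast
  then obtain L :: "complex \<Rightarrow> complex poly" where L: "\<And>w. degree (L w) < card Z"
    "\<And>w z. z \<in> Z \<Longrightarrow> poly (L w) z = (if z = w then 1 else 0)" by metis
  define C where "C i = (\<Sum>w\<in>Z. B * norm (coeff (L w) i))" for i
  define D where "D = Max (C ` {..<card Z})"
  have card: "card Z > 0" using Z by (simp add: card_gt_0_iff)
  have D: "C i \<le> D" if "i < card Z" for i
    unfolding D_def using that by (intro Max_ge) auto
  have coeff_le: "norm (of_int (coeff h i) :: complex) \<le> C i"
    if h: "degree h < card Z" "\<And>z. z \<in> Z \<Longrightarrow> norm (ipoly h z) \<le> B" for h i
  proof -
    define g where "g = (\<Sum>w\<in>Z. smult (ipoly h w) (L w))"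
    \<comment> \<open>The difference vanishes on all of \<open>Z\<close> but has degree below
      \<open>card Z\<close>.\<close>
    have hg: "map_poly of_int h = g"
    proof (rule ccontr)
      let ?f = "map_poly of_int h - g"
      assume "map_poly of_int h \<noteq> g"
      then have nz: "?f \<noteq> 0" by simp
      have "degree (L w) \<le> card Z - 1" for w using L(1)[of w] by linarith
      then have "degree g \<le> card Z - 1"
        unfolding g_def by (intro degree_sum_le Z(1) order.trans[OF degree_smult_le])
      then have "degree ?f \<le> card Z - 1"
        using h(1) by (intro degree_diff_le) (auto simp: degree_map_poly_of_int)
      then have "degree ?f < card Z" using card by simp
      moreover have "poly ?f z = 0" if "z \<in> Z" for z
      proof -
        have "poly g z = (\<Sum>w\<in>Z. if z = w then ipoly h w else 0)"
          unfolding g_def poly_sum by (intro sum.cong) (auto simp: L(2) that)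
        then show ?thesis using that Z(1) by (simp add: sum.delta')
      qed
      then have "card Z \<le> card {z. poly ?f z = 0}"
        using nz by (intro card_mono poly_roots_finite) auto
      ultimately show False using card_poly_roots_bound[OF nz] by simp
    qed
    have "of_int (coeff h i) = coeff g i"
      unfolding hg[symmetric] by (simp add: coeff_map_poly)
    then have "norm (of_int (coeff h i) :: complex) = norm (\<Sum>w\<in>Z. ipoly h w * coeff (L w) i)"
      by (simp add: g_def coeff_sum)
    also have "\<dots> \<le> C i"
      unfolding C_def by (intro sum_norm_le) (auto simp: norm_mult h(2) intro: mult_right_mono)
    finally show ?thesis .
  qed
  have "{h :: int poly. degree h < card Z \<and> (\<forall>z\<in>Z. norm (ipoly h z) \<le> B)} \<subseteq>
      {h. degree h < card Z \<and> (\<forall>i<card Z. \<bar>coeff h i\<bar> \<le> \<lfloor>D\<rfloor>)}"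
  proof safe
    fix h :: "int poly" and i
    assume h: "degree h < card Z" "\<forall>z\<in>Z. norm (ipoly h z) \<le> B" and i: "i < card Z"
    have "of_int \<bar>coeff h i\<bar> = norm (of_int (coeff h i) :: complex)" by simp
    also have "\<dots> \<le> D" using coeff_le[of h i] h D[OF i] by fastforce
    finally show "\<bar>coeff h i\<bar> \<le> \<lfloor>D\<rfloor>" by (simp only: le_floor_iff)
  qed
  then show ?thesis by (rule finite_subset[OF _ finite_bounded_int_polys])
qed

text \<open>Radial projection onto a disc respects complex conjugation, which keeps the digit
  targets admissible for \<open>integer_interpolation_approx\<close>.\<close>

definition clip :: "real \<Rightarrow> complex \<Rightarrow> complex" where
  "clip T w = (if norm w \<le> T then w else of_real (T / norm w) * w)"

lemma clip_cnj: "clip T (cnj w) = cnj (clip T w)"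
  by (simp add: clip_def)

lemma norm_clip_le: "T \<ge> 0 \<Longrightarrow> norm (clip T w) \<le> T"
  by (auto simp: clip_def norm_mult norm_divide)

lemma norm_diff_clip: "T \<ge> 0 \<Longrightarrow> norm (w - clip T w) = max 0 (norm w - T)"
proof (cases "norm w \<le> T")
  case False
  assume T: "T \<ge> 0"
  have "w - clip T w = of_real (1 - T / norm w) * w"
    using False by (simp add: clip_def algebra_simps)
  then have "norm (w - clip T w) = \<bar>1 - T / norm w\<bar> * norm w"
    by (simp only: norm_mult norm_of_real)
  moreover have "T / norm w \<le> 1" using False T by (simp add: divide_le_eq)
  then have "\<bar>1 - T / norm w\<bar> = 1 - T / norm w" by simp
  moreover have "(1 - T / norm w) * norm w = norm w - T"
    using False T by (auto simp: left_diff_distrib)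
  ultimately show ?thesis using False by simp
qed (simp add: clip_def)

text \<open>Pigeonhole: two iterates coincide, and a coincidence propagates because each iterate
  determines the next.\<close>

lemma finite_orbit_eventually_periodic:
  fixes F :: "'a \<Rightarrow> 'a"
  assumes "finite S" "\<And>n. (F ^^ n) s \<in> S"
  obtains N p where "p > 0" "\<And>n. n \<ge> N \<Longrightarrow> (F ^^ (n + p)) s = (F ^^ n) s"
proof -
  have "\<not> inj (\<lambda>n. (F ^^ n) s)"
    using assms by (meson finite_subset finite_imageD image_subsetI infinite_UNIV_nat)
  then obtain i j where ij: "i < j" "(F ^^ i) s = (F ^^ j) s"
    unfolding inj_def by (metis linorder_neqE_nat)
  have "(F ^^ (n + (j - i))) s = (F ^^ n) s" if "n \<ge> i" for n
  proof -
    have "(F ^^ (n + (j - i))) s = (F ^^ (n - i)) ((F ^^ j) s)"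
      using that ij(1) by (simp flip: funpow_add[THEN fun_cong, unfolded o_def])
    also have "\<dots> = (F ^^ n) s"
      using that by (simp flip: ij(2) funpow_add[THEN fun_cong, unfolded o_def])
    finally show ?thesis .
  qed
  then show ?thesis using ij(1) that[of "j - i" i] by simp
qed

text \<open>For each \<open>x\<close> the states are integer polynomials \<open>g\<close> of degree
  below \<open>d\<close>, standing for \<open>g(\<beta>) / q\<close>. The digits lie in
  \<open>\<int>[\<beta>]\<close>, so one denominator \<open>q\<close> serves the whole
  orbit.\<close>

lemma weak_greedy_exists:
  assumes \<beta>: "norm \<beta> > 1" and int: "algebraic_int \<beta>"
    and conj: "\<And>z. galois_conjugate \<beta> z \<Longrightarrow> norm z > 1 \<Longrightarrow> z = \<beta> \<or> z = cnj \<beta>"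
  shows "\<exists>A. finite A \<and> A \<subseteq> rat_adjoin \<beta> \<and> admits_weak_greedy_ep \<beta> A"
proof -
  obtain p where p: "is_min_poly p \<beta>"
    using algebraic_min_poly algebraic_int_imp_algebraic[OF int] by blast
  obtain P where P: "p = map_poly of_int P" "lead_coeff P = 1"
    using min_poly_integral[OF int p] by blast
  define Z where "Z = {z. rpoly p z = 0}"
  define d where "d = card Z"
  have d: "degree p = d" "degree P = d" "d > 0"
    using card_min_poly_roots[OF p] degree_min_poly_pos[OF p]
    by (simp_all add: Z_def d_def P(1) degree_map_poly_of_int)
  have Z: "finite Z" "Z \<noteq> {}" using d(3) by (simp_all add: d_def card_gt_0_iff)
  have \<beta>Z: "\<beta> \<in> Z" using is_min_poly_rootD[OF p] by (simp add: Z_def)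
  have cnjZ: "cnj z \<in> Z" if "z \<in> Z" for z using that by (simp add: Z_def rpoly_cnj)
  have PZ: "ipoly P z = 0" if "z \<in> Z" for z using that by (simp add: Z_def P(1) rpoly_of_int)
  have Z_cases: "z = \<beta> \<or> z = cnj \<beta> \<or> norm z \<le> 1" if "z \<in> Z" for z
    using conj[of z] p that unfolding galois_conjugate_def Z_def by force
  obtain R where R: "R > 0"
    "\<And>y. (\<And>z. z \<in> Z \<Longrightarrow> y (cnj z) = cnj (y z)) \<Longrightarrow>
       \<exists>a. degree a < d \<and> (\<forall>z\<in>Z. norm (ipoly a z - y z) \<le> R)"
    using integer_interpolation_approx[OF Z cnjZ] unfolding d_def by metis
  \<comment> \<open>Multiplication by \<open>\<beta>\<close> takes a state of norm at most
    \<open>R\<close> to norm at most \<open>T\<close>; there clipping changes nothing, and the next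
    state again has norm at most \<open>R\<close>.\<close>
  define T where "T = norm \<beta> * R"
  have T: "T \<ge> R" "T \<ge> 0" using \<beta> R(1) by (auto simp: T_def)
  \<comment> \<open>Every digit lies within \<open>R\<close> of a clipped value, whence
    \<open>T + R\<close>. This bound depends neither on \<open>x\<close> nor on
    \<open>q\<close>.\<close>
  define A where "A = (\<lambda>a. ipoly a \<beta>) ` {a. degree a < d \<and> (\<forall>z\<in>Z. norm (ipoly a z) \<le> T + R)}"
  have "finite A"
    unfolding A_def d_def by (intro finite_imageI finite_int_polys_bounded_values Z)
  moreover have "A \<subseteq> rat_adjoin \<beta>"
    by (auto simp: A_def intro: rat_adjoin_ipoly rat_adjoin.gen)
  moreover have "\<exists>a. is_representation \<beta> A (-1) a x \<and> eventually_periodic a"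
    if x: "x \<in> rat_adjoin \<beta>" "norm x < R" for x
  proof -
    obtain h where h: "x = rpoly h \<beta>" using rat_adjoin_eq_rpoly[OF p x(1)] by blast
    obtain q :: int and f where q: "q > 0" "smult (of_int q) (h mod p) = map_poly of_int f"
      by (rule clear_denominators)
    have "degree f = degree (smult (of_int q) (h mod p))"
      unfolding q(2) by (simp add: degree_map_poly_of_int)
    then have degf: "degree f < d"
      using q(1) degree_mod_less[OF is_min_poly_neq_0[OF p], of h] d by auto
    have "rpoly (h mod p) \<beta> = x"
      using is_min_poly_rootD[OF p] h rpoly_add[of "h div p * p" "h mod p" \<beta>]
      by (simp add: rpoly_mult)
    then have xf: "x = ipoly f \<beta> / of_int q"
      using q(1) by (simp flip: rpoly_of_int q(2) add: rpoly_smult)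
    have "\<exists>a. degree a < d \<and>
        (\<forall>z\<in>Z. norm (ipoly a z - clip T (z * ipoly g z / of_int q)) \<le> R)" for g
      by (rule R(2)) (simp add: ipoly_cnj flip: clip_cnj)
    then obtain dig where dig: "\<And>g. degree (dig g) < d"
      "\<And>g z. z \<in> Z \<Longrightarrow> norm (ipoly (dig g) z - clip T (z * ipoly g z / of_int q)) \<le> R" by metis
    \<comment> \<open>A state times \<open>z\<close> minus its digit. The multiple of the monic
      \<open>P\<close> cancels the coefficient of degree \<open>d\<close> and vanishes on
      \<open>Z\<close>; the digit gets the factor \<open>q\<close> because \<open>g\<close> is a
      numerator over \<open>q\<close>.\<close>
    define F where "F g = pCons 0 g - smult (coeff g (d - 1)) P - smult q (dig g)" for g
    have degF: "degree (F g) < d" if g: "degree g < d" for g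
    proof -
      have "coeff (F g) i = 0" if i: "i > d - 1" for i
      proof -
        have "coeff (dig g) i = 0" using dig(1)[of g] i by (intro coeff_eq_0) simp
        moreover have "coeff (pCons 0 g) i = coeff g (d - 1) * coeff P i"
        proof (cases "i = d")
          case True
          then show ?thesis using d P(2) by (simp add: coeff_pCons split: nat.splits)
        next
          case False
          then have "i > d" using i by simp
          then show ?thesis using g d by (simp add: coeff_pCons coeff_eq_0 split: nat.splits)
        qed
        ultimately show ?thesis by (simp add: F_def)
      qed
      then have "degree (F g) \<le> d - 1" by (intro degree_le) simp
      then show ?thesis using d(3) by simp
    qed
    have F: "ipoly (F g) z = z * ipoly g z - of_int q * ipoly (dig g) z" if "z \<in> Z" for g z
      using PZ[OF that] by (simp add: F_def ipoly_simps)
    define v where "v g z = ipoly g z / of_int q" for g z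
    have vF: "v (F g) z = z * v g z - ipoly (dig g) z" if "z \<in> Z" for g z
      using q(1) by (simp add: v_def F[OF that] diff_divide_distrib)
    have step: "norm (v (F g) z) \<le> max 0 (norm (z * v g z) - T) + R" if "z \<in> Z" for g z
    proof -
      let ?w = "z * v g z"
      have "norm (v (F g) z) \<le> norm (?w - clip T ?w) + norm (clip T ?w - ipoly (dig g) z)"
        using norm_triangle_ineq[of "?w - clip T ?w" "clip T ?w - ipoly (dig g) z"]
        by (simp add: vF[OF that])
      also have "\<dots> \<le> max 0 (norm ?w - T) + R"
        using dig(2)[OF that, of g] T(2)
        by (intro add_mono) (simp_all add: norm_diff_clip v_def norm_minus_commute)
      finally show ?thesis .
    qed
    \<comment> \<open>\<open>B\<close> covers the starting conjugates, which may be large although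
      \<open>x\<close> is small.\<close>
    obtain B where B: "B \<ge> R" "\<And>z. z \<in> Z \<Longrightarrow> norm (v f z) \<le> B"
    proof -
      obtain B0 where "\<And>z. z \<in> Z \<Longrightarrow> norm (v f z) \<le> B0"
        using finite_imp_bounded[OF finite_imageI[OF Z(1), of "v f"]] by (auto simp: bounded_iff)
      then show ?thesis using that[of "max B0 R"] by fastforce
    qed
    have inv: "degree ((F ^^ n) f) < d \<and> norm (v ((F ^^ n) f) \<beta>) \<le> R \<and>
        (\<forall>z\<in>Z. norm (v ((F ^^ n) f) z) \<le> B)" for n
    proof (induction n)
      case 0
      then show ?case using degf x(2) B(2) by (simp add: xf v_def)
    next
      case (Suc n)
      define g where "g = (F ^^ n) f"
      have g: "degree g < d" "norm (v g \<beta>) \<le> R" "\<And>z. z \<in> Z \<Longrightarrow> norm (v g z) \<le> B"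
        using Suc by (auto simp: g_def)
      have at\<beta>: "norm (v (F g) \<beta>) \<le> R"
      proof -
        have "norm (\<beta> * v g \<beta>) \<le> T" using g(2) by (simp add: T_def norm_mult mult_left_mono)
        then show ?thesis using step[OF \<beta>Z, of g] by simp
      qed
      have "norm (v (F g) z) \<le> B" if z: "z \<in> Z" for z
        using Z_cases[OF z]
      proof (elim disjE)
        assume "z = cnj \<beta>"
        then have "norm (v (F g) z) = norm (v (F g) \<beta>)"
          by (simp add: v_def ipoly_cnj norm_divide)
        then show ?thesis using at\<beta> B(1) by simp
      next
        \<comment> \<open>The new norm is at most \<open>max 0 (B - T) + R\<close>, which is at most
          \<open>B\<close> because \<open>R \<le> T\<close> and \<open>R \<le> B\<close>.\<close>
        assume "norm z \<le> 1"
        then have "norm (z * v g z) \<le> 1 * B"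
          unfolding norm_mult using g(3)[OF z] by (intro mult_mono) auto
        then show ?thesis using step[OF z, of g] T(1) B(1) by simp
      qed (use at\<beta> B(1) in simp)
      then show ?case using degF[OF g(1)] at\<beta> by (simp flip: g_def)
    qed
    let ?S = "{g. degree g < card Z \<and> (\<forall>z\<in>Z. norm (ipoly g z) \<le> B * of_int q)}"
    have "finite ?S" by (rule finite_int_polys_bounded_values[OF Z])
    moreover have "(F ^^ n) f \<in> ?S" for n
      using inv[of n] q(1) by (auto simp: d_def v_def norm_divide field_simps)
    ultimately obtain N k where Nk: "k > 0" "\<And>n. n \<ge> N \<Longrightarrow> (F ^^ (n + k)) f = (F ^^ n) f"
      using finite_orbit_eventually_periodic[of ?S F f thesis] by blast
    define X where "X n = v ((F ^^ n) f) \<beta>" for n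
    have "\<beta> * X n - X (Suc n) \<in> A" for n
    proof -
      define g where "g = (F ^^ n) f"
      have "norm (ipoly (dig g) z) \<le> T + R" if z: "z \<in> Z" for z
        using norm_triangle_sub[of "ipoly (dig g) z" "clip T (z * ipoly g z / of_int q)"]
          dig(2)[OF z, of g] norm_clip_le[OF T(2), of "z * ipoly g z / of_int q"] by linarith
      then have "ipoly (dig g) \<beta> \<in> A" using dig(1) by (auto simp: A_def)
      then show ?thesis by (simp add: X_def vF[OF \<beta>Z] flip: g_def)
    qed
    moreover have "X 0 = x" by (simp add: X_def v_def xf)
    moreover have "X (n + k) = X n" if "n \<ge> N" for n using Nk(2)[OF that] by (simp add: X_def)
    ultimately show ?thesis
      using orbit_imp_ep_representation[OF \<beta>, of X A k N] Nk(1) by simp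
  qed
  ultimately show ?thesis using R(1) unfolding admits_weak_greedy_ep_def by blast
qed

theorem theorem2p2:
  fixes \<beta> :: complex
  assumes "norm \<beta> > 1"
  shows "(\<exists>A. finite A \<and> A \<subseteq> rat_adjoin \<beta> \<and> admits_weak_greedy_ep \<beta> A) \<longleftrightarrow>
    algebraic_int \<beta> \<and>
    (\<forall>\<beta>'. galois_conjugate \<beta> \<beta>' \<and> norm \<beta>' > 1 \<longrightarrow> \<beta>' = \<beta> \<or> \<beta>' = cnj \<beta>)"
proof (intro iffI conjI allI impI)
  assume "\<exists>A. finite A \<and> A \<subseteq> rat_adjoin \<beta> \<and> admits_weak_greedy_ep \<beta> A"
  then obtain A where A: "finite A" "A \<subseteq> rat_adjoin \<beta>" "admits_weak_greedy_ep \<beta> A" by blast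
  show "algebraic_int \<beta>" by (rule weak_greedy_imp_algebraic_int[OF assms A])
  fix \<beta>' assume "galois_conjugate \<beta> \<beta>' \<and> norm \<beta>' > 1"
  then show "\<beta>' = \<beta> \<or> \<beta>' = cnj \<beta>"
    using weak_greedy_imp_conjugates[OF assms A] by (auto simp: galois_conjugate_def)
qed (use weak_greedy_exists[OF assms] in blast)

end
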